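(* Let $A$ and $B$ be daisy cubes whose $\tau$-graphs $A^{\tau}$ and $B^{\tau}$ are forests. Then $A$ and $B$ are isomorphic if and only if $A^{\tau}$ and $B^{\tau}$ are isomorphic.
   Context: All graphs are simple. For a positive integer $h$, let $\mathcal{B}^h$ be the set of binary strings of length $h$, partially ordered by $u_1\ldots u_h \le v_1\ldots v_h$ iff $u_i\le v_i$ for all $i$. The hypercube $Q_h$ has vertex set $\mathcal{B}^h$, two strings being adjacent iff they differ in exactly one position; $Q_0$ is the one-vertex graph. For $X\subseteq \mathcal{B}^h$ (nonempty), the daisy cube generated by $X$ is the subgraph $Q_h(X)$ of $Q_h$ induced by $\{u\in\mathcal{B}^h : u\le x \text{ for some } x\in X\}$. A daisy cube is a graph (isomorphic to one) of this form. Daisy cubes are partial cubes, i.e. isometric subgraphs of hypercubes. For a connected graph $G$ with distance $d_G$, two edges $x_1x_2$ and $y_1y_2$ are in the Djoković–Winkler relation $\Theta$ if $d_G(x_1,y_1)+d_G(x_2,y_2)\ne d_G(x_1,y_2)+d_G(x_2,y_1)$. On a partial cube $\Theta$ is an equivalence relation on the edge set; its classes are the $\Theta$-classes. The $\tau$-graph $H^\tau$ of a partial cube $H$ is the graph whose vertices are the $\Theta$-classes of $H$, with two distinct $\Theta$-classes $\mathcal{E},\mathcal{F}$ adjacent iff there are edges $uv\in\mathcal{E}$ and $vw\in\mathcal{F}$ of $H$ such that $uvw$ is a convex path on three vertices, i.e. $u,w$ are nonadjacent and $v$ is their only common neighbor. A forest may have no edges. *)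

theory Defs
  imports "Graph_Theory.Graph_Theory"
begin

text \<open>
  A simple graph is a \<^locale>\<open>pair_graph\<close>: each undirected edge is represented by its two
  orientations. Isomorphism is \<^const>\<open>digraph_iso\<close>; the declared coercion \<^const>\<open>with_proj\<close> is
  inserted implicitly.
\<close>

definition strings :: "nat \<Rightarrow> bool list set" where
  "strings h = {u. length u = h}"

text \<open>The componentwise order, with \<^term>\<open>False\<close> as 0 and \<^term>\<open>True\<close> as 1.\<close>

definition string_le :: "bool list \<Rightarrow> bool list \<Rightarrow> bool" where
  "string_le u v \<longleftrightarrow> list_all2 (\<le>) u v"

definition hypercube :: "nat \<Rightarrow> bool list pair_pre_digraph" where
  "hypercube h = \<lparr>pverts = strings h,
     parcs = {(u, v). u \<in> strings h \<and> v \<in> strings h \<and> (\<exists>!i. i < h \<and> u ! i \<noteq> v ! i)}\<rparr>"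

definition down_set :: "nat \<Rightarrow> bool list set \<Rightarrow> bool list set" where
  "down_set h X = {u \<in> strings h. \<exists>x\<in>X. string_le u x}"

definition daisy_cube :: "nat \<Rightarrow> bool list set \<Rightarrow> bool list pair_pre_digraph" where
  "daisy_cube h X = \<lparr>pverts = down_set h X, parcs = Restr (parcs (hypercube h)) (down_set h X)\<rparr>"

lemma with_proj_daisy_cube:
  "with_proj (daisy_cube h X) = induce_subgraph (with_proj (hypercube h)) (down_set h X)"
  by (auto simp: daisy_cube_def induce_subgraph_def with_proj_def)

text \<open>Allowing \<^term>\<open>h = 0\<close> adds no graph up to isomorphism: it yields the one-vertex graph,
  which is also generated by the zero string of any positive length.\<close>

definition is_daisy_cube :: "'a pair_pre_digraph \<Rightarrow> bool" where
  "is_daisy_cube G \<longleftrightarrow> (\<exists>h X. X \<noteq> {} \<and> X \<subseteq> strings h \<and> digraph_iso G (daisy_cube h X))"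

definition edges :: "'a pair_pre_digraph \<Rightarrow> 'a set set" where
  "edges G = (\<lambda>(u, v). {u, v}) ` parcs G"

definition gdist :: "'a pair_pre_digraph \<Rightarrow> 'a \<Rightarrow> 'a \<Rightarrow> ereal" where
  "gdist G u v = wf_digraph.\<mu> G (\<lambda>_. 1) u v"

text \<open>The defining inequality does not depend on the chosen orientations of the two edges.\<close>

definition Theta :: "'a pair_pre_digraph \<Rightarrow> 'a set rel" where
  "Theta G = {({x1, x2}, {y1, y2}) | x1 x2 y1 y2.
     (x1, x2) \<in> parcs G \<and> (y1, y2) \<in> parcs G \<and>
     gdist G x1 y1 + gdist G x2 y2 \<noteq> gdist G x1 y2 + gdist G x2 y1}"

text \<open>\<^term>\<open>Theta G\<close> is an equivalence relation on \<^term>\<open>edges G\<close> when \<open>G\<close> is a partial cube; only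
  then is the following quotient meaningful.\<close>

definition Theta_classes :: "'a pair_pre_digraph \<Rightarrow> 'a set set set" where
  "Theta_classes G = edges G // Theta G"

definition convex_path3 :: "'a pair_pre_digraph \<Rightarrow> 'a \<Rightarrow> 'a \<Rightarrow> 'a \<Rightarrow> bool" where
  "convex_path3 G u v w \<longleftrightarrow>
     (u, v) \<in> parcs G \<and> (v, w) \<in> parcs G \<and> u \<noteq> w \<and> (u, w) \<notin> parcs G \<and>
     (\<forall>x. (u, x) \<in> parcs G \<and> (x, w) \<in> parcs G \<longrightarrow> x = v)"

definition tau_graph :: "'a pair_pre_digraph \<Rightarrow> 'a set set pair_pre_digraph" where
  "tau_graph G = \<lparr>pverts = Theta_classes G,
     parcs = {(E, F). E \<in> Theta_classes G \<and> F \<in> Theta_classes G \<and> E \<noteq> F \<and>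
       (\<exists>u v w. {u, v} \<in> E \<and> {v, w} \<in> F \<and> convex_path3 G u v w)}\<rparr>"

text \<open>
  \<^const>\<open>forest\<close> is not suitable for symmetric digraphs, since there \<open>a, b, a\<close> is a cycle. In a
  simple graph the undirected cycles are the cycles of length at least 3.
\<close>

definition is_forest :: "'a pair_pre_digraph \<Rightarrow> bool" where
  "is_forest G \<longleftrightarrow> \<not> (\<exists>p. pre_digraph.cycle G p \<and> length p \<ge> 3)"

end

theory Submission
  imports Defs
begin

text \<open>
  That isomorphic graphs have isomorphic \<open>\<tau>\<close>-graphs holds for all graphs, because distances, the
  relation \<open>\<Theta>\<close> and convex paths are carried over by isomorphisms (lemma
  \<open>graph_iso_tau_graph\<close>). The substance is the converse: a daisy cube can be recovered from its
  \<open>\<tau>\<close>-graph if that is a forest.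

  Reading a binary string as the set of positions of its ones turns a daisy cube into the graph of
  faces of a simplicial complex \<open>K\<close>, two faces being adjacent iff they differ in one vertex of
  \<open>K\<close>. The distance of two faces is the size of their symmetric difference, since one can first
  delete and then add vertices without leaving \<open>K\<close>. Hence two edges are in relation \<open>\<Theta>\<close> iff they
  change the same vertex of \<open>K\<close>, and the \<open>\<Theta>\<close>-classes correspond to the vertices of \<open>K\<close> (lemma
  \<open>Theta_classes_face_graph\<close>). A convex path on three vertices is a square of the hypercube with
  one corner missing from \<open>K\<close>. By downward closure the missing corner is the top one, so vertices
  \<open>i\<close> and \<open>j\<close> are adjacent in the \<open>\<tau>\<close>-graph iff for some \<open>S\<close> containing neither, \<open>S \<union> {i}\<close> and
  \<open>S \<union> {j}\<close> are faces but \<open>S \<union> {i, j}\<close> is not (lemma \<open>parcs_tau_graph_face_graph\<close>).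

  In particular any two vertices of a minimal nonface \<open>M\<close> are adjacent in the \<open>\<tau>\<close>-graph: take
  \<open>S = M - {i, j}\<close>. A forest has no triangle, so every minimal nonface among the vertices has
  exactly two elements. Then the nonfaces of size two are precisely the edges of the
  \<open>\<tau>\<close>-graph, and the faces are precisely its finite independent sets (lemma
  \<open>face_iff_no_tau_adjacent\<close>). An isomorphism of the \<open>\<tau>\<close>-graphs is therefore a bijection
  of the vertices of two complexes that matches their faces, and it induces an isomorphism of the
  daisy cubes.
\<close>

section \<open>Isomorphisms of simple graphs\<close>

text \<open>
  The notion \<^const>\<open>digraph_iso\<close> carries a separate map on arcs and prescribed endpoint maps. Between
  graphs whose arcs are pairs all of these are determined by the map on vertices, which is made
  explicit here.
\<close>

definition graph_iso :: "('a \<Rightarrow> 'b) \<Rightarrow> 'a pair_pre_digraph \<Rightarrow> 'b pair_pre_digraph \<Rightarrow> bool" where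
  "graph_iso f G H \<longleftrightarrow> pair_wf_digraph G \<and> pair_wf_digraph H \<and> bij_betw f (pverts G) (pverts H) \<and>
     (\<forall>u\<in>pverts G. \<forall>v\<in>pverts G. (u, v) \<in> parcs G \<longleftrightarrow> (f u, f v) \<in> parcs H)"

lemma pair_wf_digraphD:
  "pair_wf_digraph G \<Longrightarrow> (u, v) \<in> parcs G \<Longrightarrow> u \<in> pverts G \<and> v \<in> pverts G"
  by (metis pair_wf_digraph.in_arcsD1 pair_wf_digraph.in_arcsD2)

lemma graph_isoD:
  assumes "graph_iso f G H"
  shows "pair_wf_digraph G" "pair_wf_digraph H" "inj_on f (pverts G)" "f ` pverts G = pverts H"
    "u \<in> pverts G \<Longrightarrow> v \<in> pverts G \<Longrightarrow> (f u, f v) \<in> parcs H \<longleftrightarrow> (u, v) \<in> parcs G"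
    "(u, v) \<in> parcs G \<Longrightarrow> (f u, f v) \<in> parcs H"
  using assms pair_wf_digraphD[of G u v] by (auto simp: graph_iso_def bij_betw_def)

lemma graph_iso_arcE:
  assumes "graph_iso f G H" "(x, y) \<in> parcs H"
  obtains u v where "x = f u" "y = f v" "(u, v) \<in> parcs G"
proof -
  have "x \<in> f ` pverts G" "y \<in> f ` pverts G"
    using assms graph_isoD(2,4)[OF assms(1)] pair_wf_digraphD[of H x y] by auto
  then show thesis
    using that assms graph_isoD(5)[OF assms(1)] by blast
qed

lemma graph_iso_parcs: "graph_iso f G H \<Longrightarrow> parcs H = map_prod f f ` parcs G"
  by (fastforce dest: graph_isoD(6) elim: graph_iso_arcE)

lemma graph_iso_sym: "graph_iso f G H \<Longrightarrow> graph_iso (inv_into (pverts G) f) H G"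
  unfolding graph_iso_def
  by (auto simp: bij_betw_inv_into) (metis bij_betw_def f_inv_into_f inv_into_into)+

lemma graph_iso_trans: "graph_iso f G H \<Longrightarrow> graph_iso g H I \<Longrightarrow> graph_iso (g \<circ> f) G I"
  unfolding graph_iso_def by (auto intro: bij_betw_trans dest: bij_betwE)

text \<open>
  In \<^const>\<open>app_iso\<close> the endpoint maps of the target are those of the isomorphism record. As the
  target is a graph of pairs they must be the projections, which forces the arc map to be
  \<open>(u, v) \<mapsto> (f u, f v)\<close>.
\<close>

lemma digraph_iso_iff_graph_iso: "digraph_iso G H \<longleftrightarrow> (\<exists>f. graph_iso f G H)"
  for G :: "'a pair_pre_digraph" and H :: "'b pair_pre_digraph"
proof
  assume "digraph_iso G H"
  then obtain h where h: "pre_digraph.digraph_isomorphism G h" and H: "with_proj H = app_iso h G"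
    by (auto simp: digraph_iso_def)
  let ?f = "iso_verts h"
  have G: "pair_wf_digraph G"
    using h by (auto simp: pre_digraph.digraph_isomorphism_def wf_digraph_wp_iff)
  have wfH: "pair_wf_digraph H"
    using wf_digraph.wf_digraphI_app_iso[OF _ h] G unfolding H[symmetric] wf_digraph_wp_iff .
  have V: "pverts H = ?f ` pverts G" and E: "parcs H = iso_arcs h ` parcs G"
    and t: "iso_tail h = fst" and hd: "iso_head h = snd"
    using arg_cong[OF H, of verts] arg_cong[OF H, of arcs] arg_cong[OF H, of tail]
      arg_cong[OF H, of head] by auto
  have inj: "inj_on ?f (pverts G)"
    using h by (auto simp: pre_digraph.digraph_isomorphism_def)
  have arc: "iso_arcs h (u, v) = (?f u, ?f v)" if "(u, v) \<in> parcs G" for u v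
    using h that t hd by (force simp: pre_digraph.digraph_isomorphism_def prod_eq_iff)
  have "(u, v) \<in> parcs G \<longleftrightarrow> (?f u, ?f v) \<in> parcs H" if uv: "u \<in> pverts G" "v \<in> pverts G" for u v
  proof
    show "(?f u, ?f v) \<in> parcs H" if "(u, v) \<in> parcs G"
      using that arc E by (metis imageI)
  next
    assume "(?f u, ?f v) \<in> parcs H"
    then obtain a b where ab: "(a, b) \<in> parcs G" "iso_arcs h (a, b) = (?f u, ?f v)"
      using E by auto
    then have "?f a = ?f u" "?f b = ?f v" using arc by auto
    then show "(u, v) \<in> parcs G"
      using ab uv inj pair_wf_digraphD[OF G ab(1)] by (metis inj_onD)
  qed
  then show "\<exists>f. graph_iso f G H"
    using G wfH V inj by (auto simp: graph_iso_def bij_betw_def)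
next
  assume "\<exists>f. graph_iso f G H"
  then obtain f where f: "graph_iso f G H" ..
  let ?h = "\<lparr>iso_verts = f, iso_arcs = map_prod f f, iso_head = snd, iso_tail = fst\<rparr>"
  have "parcs G \<subseteq> pverts G \<times> pverts G"
    using pair_wf_digraphD[OF graph_isoD(1)[OF f]] by auto
  then have "inj_on (map_prod f f) (parcs G)"
    by (rule inj_on_subset[OF map_prod_inj_on[OF graph_isoD(3)[OF f] graph_isoD(3)[OF f]]])
  then have "pre_digraph.digraph_isomorphism G ?h"
    using graph_isoD(1,3)[OF f] by (auto simp: pre_digraph.digraph_isomorphism_def wf_digraph_wp_iff)
  moreover have "with_proj H = app_iso ?h G"
    by (simp add: with_proj_def app_iso_def graph_isoD(4)[OF f] graph_iso_parcs[OF f])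
  ultimately show "digraph_iso G H" by (auto simp: digraph_iso_def)
qed

section \<open>The \<open>\<tau>\<close>-graph is an isomorphism invariant\<close>

text \<open>
  With unit weights the cost of a walk is its length. The infimum over no walks is \<open>\<infinity>\<close>, so this
  covers disconnected graphs as well.
\<close>

lemma gdist_eq_INF:
  "pair_wf_digraph G \<Longrightarrow>
    gdist G u v = (INF p\<in>{p. pre_digraph.awalk G u p v}. ereal (real (length p)))"
proof -
  assume "pair_wf_digraph G"
  then interpret pair_wf_digraph G .
  have "awalk_cost (\<lambda>_. 1) p = real (length p)" for p :: "('a \<times> 'a) list"
    by (induction p) auto
  then show ?thesis by (simp add: gdist_def \<mu>_def)
qed

lemma awalk_graph_iso:
  assumes f: "graph_iso f G H" and "pre_digraph.awalk G u p v"
  shows "pre_digraph.awalk H (f u) (map (map_prod f f) p) (f v)"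
proof -
  have "pcas u p v \<Longrightarrow> pcas (f u) (map (map_prod f f) p) (f v)"
    by (induction p arbitrary: u) auto
  then show ?thesis
    using assms graph_isoD(4)[OF f] graph_isoD(6)[OF f]
    by (force simp: pre_digraph.awalk_def cas_with_proj_eq)
qed

text \<open>
  An isomorphism maps walks to walks of the same length. The reverse inequality comes from
  applying this to the inverse isomorphism.
\<close>

lemma gdist_graph_iso_le:
  assumes f: "graph_iso f G H"
  shows "gdist H (f u) (f v) \<le> gdist G u v"
  unfolding gdist_eq_INF[OF graph_isoD(1)[OF f]] gdist_eq_INF[OF graph_isoD(2)[OF f]]
proof (rule INF_mono)
  fix p assume "p \<in> {p. pre_digraph.awalk G u p v}"
  then show "\<exists>q\<in>{q. pre_digraph.awalk H (f u) q (f v)}. ereal (real (length q)) \<le> ereal (real (length p))"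
    using awalk_graph_iso[OF f] by (metis length_map mem_Collect_eq order_refl)
qed

lemma gdist_graph_iso:
  assumes f: "graph_iso f G H" and "u \<in> pverts G" "v \<in> pverts G"
  shows "gdist H (f u) (f v) = gdist G u v"
  using gdist_graph_iso_le[OF f, of u v] gdist_graph_iso_le[OF graph_iso_sym[OF f], of "f u" "f v"]
    assms graph_isoD(3)[OF f] by (simp add: inv_into_f_f)

lemma edges_graph_iso: "graph_iso f G H \<Longrightarrow> edges H = image f ` edges G"
  by (force simp: edges_def graph_iso_parcs image_image split_beta)

lemma edge_subset_pverts: "pair_wf_digraph G \<Longrightarrow> e \<in> edges G \<Longrightarrow> e \<subseteq> pverts G"
  by (auto simp: edges_def dest: pair_wf_digraphD)

lemma Theta_subset_edges: "Theta G \<subseteq> edges G \<times> edges G"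
  by (auto simp: Theta_def edges_def)

lemma ThetaI:
  assumes "(x1, x2) \<in> parcs G" "(y1, y2) \<in> parcs G"
    and "gdist G x1 y1 + gdist G x2 y2 \<noteq> gdist G x1 y2 + gdist G x2 y1"
  shows "({x1, x2}, {y1, y2}) \<in> Theta G"
  using assms unfolding Theta_def by blast

lemma Theta_graph_iso:
  assumes f: "graph_iso f G H"
  shows "Theta H = map_prod (image f) (image f) ` Theta G"
proof (intro equalityI subsetI)
  fix e assume "e \<in> Theta H"
  then obtain x1 x2 y1 y2 where e: "e = ({x1, x2}, {y1, y2})"
    "(x1, x2) \<in> parcs H" "(y1, y2) \<in> parcs H"
    "gdist H x1 y1 + gdist H x2 y2 \<noteq> gdist H x1 y2 + gdist H x2 y1"
    by (auto simp: Theta_def)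
  obtain u1 u2 where u: "x1 = f u1" "x2 = f u2" "(u1, u2) \<in> parcs G"
    using graph_iso_arcE[OF f e(2)] .
  obtain v1 v2 where v: "y1 = f v1" "y2 = f v2" "(v1, v2) \<in> parcs G"
    using graph_iso_arcE[OF f e(3)] .
  have "({u1, u2}, {v1, v2}) \<in> Theta G"
    using e(4) u v gdist_graph_iso[OF f] pair_wf_digraphD[OF graph_isoD(1)[OF f]]
    by (intro ThetaI) auto
  then show "e \<in> map_prod (image f) (image f) ` Theta G"
    using e(1) u v by (force simp: image_iff)
next
  fix e assume "e \<in> map_prod (image f) (image f) ` Theta G"
  then obtain u1 u2 v1 v2 where e: "e = ({f u1, f u2}, {f v1, f v2})"
    "(u1, u2) \<in> parcs G" "(v1, v2) \<in> parcs G"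
    "gdist G u1 v1 + gdist G u2 v2 \<noteq> gdist G u1 v2 + gdist G u2 v1"
    by (auto simp: Theta_def)
  then show "e \<in> Theta H"
    using graph_isoD(6)[OF f] gdist_graph_iso[OF f] pair_wf_digraphD[OF graph_isoD(1)[OF f]]
    by (auto intro!: ThetaI)
qed

text \<open>
  An injection on vertices is injective on sets of vertices, hence on edges and, one level up, on
  sets of edges. This is what turns transport of \<open>\<Theta>\<close> into transport of its classes.
\<close>

lemma inj_on_image_edges:
  assumes "graph_iso f G H" shows "inj_on (image f) (edges G)"
  using edge_subset_pverts[OF graph_isoD(1)[OF assms]] graph_isoD(3)[OF assms]
  by (auto simp: inj_on_def[of "image f"] inj_on_image_eq_iff)

lemma Theta_class_subset_edges: "E \<in> Theta_classes G \<Longrightarrow> E \<subseteq> edges G"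
  using Theta_subset_edges[of G] by (auto simp: Theta_classes_def quotient_def)

lemma Theta_classes_graph_iso:
  assumes f: "graph_iso f G H"
  shows "Theta_classes H = image (image f) ` Theta_classes G"
proof -
  have "Theta H `` {f ` e} = image f ` (Theta G `` {e})" if "e \<in> edges G" for e
  proof (intro equalityI subsetI)
    fix x assume "x \<in> Theta H `` {f ` e}"
    then obtain a b where ab: "(a, b) \<in> Theta G" "f ` a = f ` e" "x = f ` b"
      by (auto simp: Theta_graph_iso[OF f])
    then have "a = e"
      using that Theta_subset_edges[of G] inj_onD[OF inj_on_image_edges[OF f]] by blast
    then show "x \<in> image f ` (Theta G `` {e})" using ab by blast
  next
    fix x assume "x \<in> image f ` (Theta G `` {e})"
    then show "x \<in> Theta H `` {f ` e}"
      using map_prod_imageI[of e _ "Theta G" "image f" "image f"]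
      by (auto simp: Theta_graph_iso[OF f])
  qed
  then show ?thesis
    by (auto simp: Theta_classes_def quotient_def edges_graph_iso[OF f] image_iff)
qed

lemma convex_path3_graph_iso:
  assumes f: "graph_iso f G H" and "u \<in> pverts G" "v \<in> pverts G" "w \<in> pverts G"
  shows "convex_path3 H (f u) (f v) (f w) \<longleftrightarrow> convex_path3 G u v w"
proof -
  have "(\<forall>x. (f u, x) \<in> parcs H \<and> (x, f w) \<in> parcs H \<longrightarrow> x = f v) \<longleftrightarrow>
        (\<forall>x. (u, x) \<in> parcs G \<and> (x, w) \<in> parcs G \<longrightarrow> x = v)"
    (is "?L \<longleftrightarrow> ?R")
  proof
    show ?R if ?L
      using that assms graph_isoD(3,6)[OF f] pair_wf_digraphD[OF graph_isoD(1)[OF f]]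
      by (metis inj_onD)
    show ?L if ?R
    proof (intro allI impI)
      fix x assume x: "(f u, x) \<in> parcs H \<and> (x, f w) \<in> parcs H"
      then obtain a where "a \<in> pverts G" "x = f a"
        using graph_isoD(4)[OF f] pair_wf_digraphD[OF graph_isoD(2)[OF f]] by blast
      then show "x = f v" using x that assms graph_isoD(5)[OF f] by blast
    qed
  qed
  moreover have "f u = f w \<longleftrightarrow> u = w"
    using assms graph_isoD(3)[OF f] by (auto dest: inj_onD)
  ultimately show ?thesis
    using assms by (simp add: convex_path3_def graph_isoD(5)[OF f])
qed

lemma convex_path3_pverts:
  "pair_wf_digraph G \<Longrightarrow> convex_path3 G u v w \<Longrightarrow> u \<in> pverts G \<and> v \<in> pverts G \<and> w \<in> pverts G"
  by (auto simp: convex_path3_def dest: pair_wf_digraphD)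

lemma pair_wf_digraph_tau_graph: "pair_wf_digraph (tau_graph G)"
  by (auto simp: pair_wf_digraph_def tau_graph_def)

text \<open>
  Classes are sets of sets of vertices, so the vertex map acts on them by taking images twice.
\<close>

lemma graph_iso_tau_graph:
  assumes f: "graph_iso f G H"
  shows "graph_iso (image (image f)) (tau_graph G) (tau_graph H)"
proof -
  let ?F = "image (image f)"
  have inj: "inj_on ?F (Theta_classes G)"
    using inj_on_image_edges[OF f] Theta_class_subset_edges
    by (metis (no_types, lifting) inj_on_def inj_on_image_eq_iff)
  \<comment> \<open>The image of a class contains no edges other than the images of its own edges.\<close>
  have mem: "{f u, f v} \<in> ?F E \<longleftrightarrow> {u, v} \<in> E"
    if E: "E \<in> Theta_classes G" and uv: "u \<in> pverts G" "v \<in> pverts G" for E u v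
  proof
    assume "{f u, f v} \<in> ?F E"
    then obtain e where e: "e \<in> E" "f ` e = f ` {u, v}" by auto
    then have "e \<subseteq> pverts G"
      using E Theta_class_subset_edges edge_subset_pverts[OF graph_isoD(1)[OF f]] by blast
    then have "e = {u, v}"
      using e(2) uv inj_on_image_eq_iff[OF graph_isoD(3)[OF f]] by blast
    then show "{u, v} \<in> E" using e(1) by simp
  next
    assume "{u, v} \<in> E"
    then show "{f u, f v} \<in> ?F E" using imageI[of "{u, v}" E "image f"] by simp
  qed
  have path: "(\<exists>x y z. {x, y} \<in> ?F E \<and> {y, z} \<in> ?F F \<and> convex_path3 H x y z) \<longleftrightarrow>
      (\<exists>u v w. {u, v} \<in> E \<and> {v, w} \<in> F \<and> convex_path3 G u v w)" (is "?L \<longleftrightarrow> ?R")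
    if E: "E \<in> Theta_classes G" and F: "F \<in> Theta_classes G" for E F
  proof
    assume ?L
    then obtain x y z where xyz: "{x, y} \<in> ?F E" "{y, z} \<in> ?F F" "convex_path3 H x y z" by blast
    then have "x \<in> f ` pverts G" "y \<in> f ` pverts G" "z \<in> f ` pverts G"
      using convex_path3_pverts[OF graph_isoD(2)[OF f]] graph_isoD(4)[OF f] by auto
    then obtain u v w where eq: "x = f u" "y = f v" "z = f w"
        and uvw: "u \<in> pverts G" "v \<in> pverts G" "w \<in> pverts G" by blast
    have "{u, v} \<in> E" "{v, w} \<in> F"
      using xyz(1,2) mem[OF E uvw(1,2)] mem[OF F uvw(2,3)] by (simp_all only: eq)
    moreover have "convex_path3 G u v w"
      using xyz(3) convex_path3_graph_iso[OF f uvw] by (simp only: eq)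
    ultimately show ?R by blast
  next
    assume ?R
    then obtain u v w where uvw: "{u, v} \<in> E" "{v, w} \<in> F" "convex_path3 G u v w" by blast
    then have V: "u \<in> pverts G" "v \<in> pverts G" "w \<in> pverts G"
      using convex_path3_pverts[OF graph_isoD(1)[OF f]] by blast+
    have "{f u, f v} \<in> ?F E" "{f v, f w} \<in> ?F F" "convex_path3 H (f u) (f v) (f w)"
      using uvw mem[OF E V(1,2)] mem[OF F V(2,3)] convex_path3_graph_iso[OF f V] by (simp_all only:)
    then show ?L by blast
  qed
  have "?F E = ?F F \<longleftrightarrow> E = F" if "E \<in> Theta_classes G" "F \<in> Theta_classes G" for E F
    using that inj by (auto dest: inj_onD)
  then show ?thesis
    unfolding graph_iso_def using inj path
    by (intro conjI pair_wf_digraph_tau_graph)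
      (auto simp: bij_betw_def tau_graph_def Theta_classes_graph_iso[OF f])
qed

section \<open>Triangles\<close>

definition triangle_free :: "'a pair_pre_digraph \<Rightarrow> bool" where
  "triangle_free G \<longleftrightarrow> \<not> (\<exists>a b c. a \<noteq> b \<and> b \<noteq> c \<and> a \<noteq> c \<and>
     (a, b) \<in> parcs G \<and> (b, c) \<in> parcs G \<and> (c, a) \<in> parcs G)"

text \<open>
  The forest condition enters the reconstruction here: a minimal nonface with three or more elements
  would give a triangle of the \<open>\<tau>\<close>-graph.
\<close>

lemma triangle_free_if_is_forest:
  assumes G: "pair_wf_digraph G" and "is_forest G" shows "triangle_free G"
  unfolding triangle_free_def
proof safe
  interpret pair_wf_digraph G by (rule G)
  fix a b c
  assume abc: "a \<noteq> b" "b \<noteq> c" "a \<noteq> c" "(a, b) \<in> parcs G" "(b, c) \<in> parcs G" "(c, a) \<in> parcs G"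
  then have "cycle [(a, b), (b, c), (c, a)]"
    by (auto simp: cycle_def awalk_def dest: in_arcsD1 intro!: exI[of _ a])
  then show False using assms(2) unfolding is_forest_def
    by (metis One_nat_def add_Suc_right le_refl length_Cons list.size(3) numeral_3_eq_3 plus_nat.add_0)
qed

lemma triangle_free_graph_iso:
  assumes f: "graph_iso f G H" and "triangle_free H" shows "triangle_free G"
  unfolding triangle_free_def
proof safe
  fix a b c
  assume abc: "a \<noteq> b" "b \<noteq> c" "a \<noteq> c" "(a, b) \<in> parcs G" "(b, c) \<in> parcs G" "(c, a) \<in> parcs G"
  then have "a \<in> pverts G" "b \<in> pverts G" "c \<in> pverts G"
    using pair_wf_digraphD[OF graph_isoD(1)[OF f]] by blast+
  then have "f a \<noteq> f b" "f b \<noteq> f c" "f a \<noteq> f c"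
    using abc graph_isoD(3)[OF f] by (auto dest: inj_onD)
  then show False
    using assms(2) abc graph_isoD(6)[OF f] unfolding triangle_free_def by blast
qed

section \<open>Daisy cubes as graphs of faces of simplicial complexes\<close>

text \<open>
  The coordinate-free form of an induced subgraph of a hypercube: strings are replaced by their
  supports, and differing in one position becomes a singleton symmetric difference.
\<close>

definition face_graph :: "'v set set \<Rightarrow> 'v set pair_pre_digraph" where
  "face_graph K = \<lparr>pverts = K, parcs = {(S, T). S \<in> K \<and> T \<in> K \<and> (\<exists>i. sym_diff S T = {i})}\<rparr>"

lemma parcs_face_graph_iff:
  "(S, T) \<in> parcs (face_graph K) \<longleftrightarrow> S \<in> K \<and> T \<in> K \<and> (\<exists>i. sym_diff S T = {i})"
  by (simp add: face_graph_def)

lemma pair_wf_digraph_face_graph: "pair_wf_digraph (face_graph K)"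
  by (auto simp: pair_wf_digraph_def face_graph_def)

text \<open>
  A pointwise form, which keeps set reasoning about neighbouring faces propositional.
\<close>

lemma sym_diff_eq_singleton_iff: "sym_diff S T = {i} \<longleftrightarrow> (\<forall>x. (x \<in> S \<longleftrightarrow> x \<notin> T) \<longleftrightarrow> x = i)"
  unfolding set_eq_iff by blast

text \<open>
  The members of \<open>K\<close> are its faces and the elements of \<open>\<Union>K\<close> its vertices. The empty face is the
  bottom string of a daisy cube; it is present because a daisy cube has a nonempty set of generators.
\<close>

locale simplicial_complex =
  fixes K :: "'v set set"
  assumes finite_face: "S \<in> K \<Longrightarrow> finite S"
    and face_subset: "S \<in> K \<Longrightarrow> T \<subseteq> S \<Longrightarrow> T \<in> K"
    and empty_face: "{} \<in> K"

definition support :: "bool list \<Rightarrow> nat set" where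
  "support u = {i. i < length u \<and> u ! i}"

lemma inj_on_support: "inj_on support (strings h)"
proof (rule inj_onI)
  fix u v assume uv: "u \<in> strings h" "v \<in> strings h" and eq: "support u = support v"
  have "u ! i \<longleftrightarrow> v ! i" if "i < h" for i
    using eqset_imp_iff[OF eq, of i] uv that by (simp add: support_def strings_def)
  then show "u = v" using uv by (intro nth_equalityI) (auto simp: strings_def)
qed

lemma sym_diff_support:
  "u \<in> strings h \<Longrightarrow> v \<in> strings h \<Longrightarrow> sym_diff (support u) (support v) = {i. i < h \<and> u ! i \<noteq> v ! i}"
  by (auto simp: support_def strings_def)

lemma string_le_iff_support:
  "u \<in> strings h \<Longrightarrow> v \<in> strings h \<Longrightarrow> string_le u v \<longleftrightarrow> support u \<subseteq> support v"
  by (auto simp: string_le_def support_def strings_def list_all2_conv_all_nth)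

lemma exists_string_with_support:
  assumes "S \<subseteq> {..<h}" obtains u where "u \<in> strings h" "support u = S"
proof (rule that[of "map (\<lambda>i. i \<in> S) [0..<h]"])
  show "support (map (\<lambda>i. i \<in> S) [0..<h]) = S"
    using assms by (auto simp: support_def)
qed (simp add: strings_def)

lemma support_subset: "u \<in> strings h \<Longrightarrow> support u \<subseteq> {..<h}"
  by (auto simp: support_def strings_def)

lemma simplicial_complex_support_down_set:
  assumes "X \<noteq> {}" "X \<subseteq> strings h"
  shows "simplicial_complex (support ` down_set h X)"
proof
  show "finite S" if "S \<in> support ` down_set h X" for S
    using that by (auto simp: support_def)
  show down: "T \<in> support ` down_set h X" if S: "S \<in> support ` down_set h X" and "T \<subseteq> S" for S T
  proof -
    obtain u x where u: "S = support u" "u \<in> strings h" "x \<in> X" "string_le u x"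
      using S by (auto simp: down_set_def)
    obtain v where v: "v \<in> strings h" "support v = T"
      using exists_string_with_support[of T h] \<open>T \<subseteq> S\<close> u support_subset by blast
    have "string_le v x"
      using u v \<open>T \<subseteq> S\<close> assms(2) string_le_iff_support[of _ h x] by blast
    then show ?thesis using u(3) v by (auto simp: down_set_def)
  qed
  obtain x where "x \<in> X" using assms(1) by blast
  then have "support x \<in> support ` down_set h X"
    using assms(2) string_le_iff_support[of x h x] by (auto simp: down_set_def)
  then show "{} \<in> support ` down_set h X" using down by blast
qed

lemma graph_iso_support: "graph_iso support (daisy_cube h X) (face_graph (support ` down_set h X))"
proof -
  have D: "down_set h X \<subseteq> strings h" by (auto simp: down_set_def)
  have "(u, v) \<in> parcs (daisy_cube h X) \<longleftrightarrow>
      (support u, support v) \<in> parcs (face_graph (support ` down_set h X))"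
    if "u \<in> down_set h X" "v \<in> down_set h X" for u v
  proof -
    have uv: "u \<in> strings h" "v \<in> strings h" using that D by auto
    have "(\<exists>!i. i < h \<and> u ! i \<noteq> v ! i) \<longleftrightarrow> (\<exists>i. sym_diff (support u) (support v) = {i})"
      unfolding sym_diff_support[OF uv] by (auto simp: set_eq_iff Ex1_def)
    then show ?thesis
      using that uv by (simp add: daisy_cube_def hypercube_def face_graph_def)
  qed
  then show ?thesis
    using inj_on_subset[OF inj_on_support D]
    by (auto simp: graph_iso_def pair_wf_digraph_face_graph bij_betw_def)
      (auto simp: pair_wf_digraph_def daisy_cube_def face_graph_def)
qed

lemma is_daisy_cubeE:
  assumes "is_daisy_cube G"
  obtains f and K :: "nat set set" where "simplicial_complex K" "graph_iso f G (face_graph K)"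
proof -
  obtain h X where X: "X \<noteq> {}" "X \<subseteq> strings h" and "digraph_iso G (daisy_cube h X)"
    using assms by (auto simp: is_daisy_cube_def)
  then obtain f where "graph_iso f G (daisy_cube h X)"
    by (auto simp: digraph_iso_iff_graph_iso)
  then show thesis
    using that graph_iso_trans graph_iso_support simplicial_complex_support_down_set[OF X] by blast
qed

section \<open>Distances and \<open>\<Theta>\<close>-classes in a graph of faces\<close>

context simplicial_complex
begin

text \<open>
  A shortest walk changes one element of the symmetric difference at a time. As long as \<open>S\<close> has
  elements outside \<open>T\<close> one of them is deleted; after that \<open>S \<subseteq> T\<close> and adding elements of \<open>T\<close> stays
  below the face \<open>T\<close>. Both kinds of steps remain in \<open>K\<close> by downward closure.
\<close>

lemma awalk_face_graph:
  assumes "S \<in> K" "T \<in> K"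
  shows "\<exists>p. pre_digraph.awalk (face_graph K) S p T \<and> length p = card (sym_diff S T)"
  using assms
proof (induction "card (sym_diff S T)" arbitrary: S)
  case 0
  then have "S = T" using finite_face by auto
  then show ?case
    using 0 by (intro exI[of _ "[]"]) (auto simp: pre_digraph.awalk_def cas_with_proj_eq face_graph_def)
next
  case (Suc n)
  have "sym_diff S T \<noteq> {}" using Suc.hyps(2) by (metis card.empty nat.distinct(1))
  have "\<exists>i\<in>sym_diff S T. \<exists>S'\<in>K. sym_diff S S' = {i} \<and> sym_diff S' T = sym_diff S T - {i}"
  proof (cases "S \<subseteq> T")
    case True
    then obtain i where i: "i \<in> T - S" using \<open>sym_diff S T \<noteq> {}\<close> by blast
    then have "insert i S \<in> K" using True Suc.prems face_subset[of T] by auto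
    then show ?thesis using i True by (intro bexI[of _ i] bexI[of _ "insert i S"]) auto
  next
    case False
    then obtain i where i: "i \<in> S - T" by auto
    then have "S - {i} \<in> K" using Suc.prems face_subset[of S] by auto
    then show ?thesis using i by (intro bexI[of _ i] bexI[of _ "S - {i}"]) auto
  qed
  then obtain i S' where i: "i \<in> sym_diff S T" "S' \<in> K" "sym_diff S S' = {i}"
    "sym_diff S' T = sym_diff S T - {i}" by blast
  then have "n = card (sym_diff S' T)" using Suc.hyps(2) by (simp only: card_Diff_singleton)
  then obtain p where p: "pre_digraph.awalk (face_graph K) S' p T" "length p = n"
    using Suc.hyps(1)[of S'] i Suc.prems by auto
  then have "pre_digraph.awalk (face_graph K) S ((S, S') # p) T"
    using i Suc.prems by (auto simp: pre_digraph.awalk_def cas_with_proj_eq face_graph_def)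
  then show ?case using p Suc.hyps(2) by (metis length_Cons)
qed

lemma card_sym_diff_le_length_awalk:
  assumes "pre_digraph.awalk (face_graph K) S p T"
  shows "card (sym_diff S T) \<le> length p"
  using assms
proof (induction p arbitrary: S)
  case Nil
  then show ?case by (auto simp: pre_digraph.awalk_def cas_with_proj_eq)
next
  case (Cons e p)
  obtain S' where e: "e = (S, S')" "(S, S') \<in> parcs (face_graph K)"
      and p: "pre_digraph.awalk (face_graph K) S' p T"
    using Cons.prems by (cases e) (auto simp: pre_digraph.awalk_def cas_with_proj_eq face_graph_def)
  obtain i where i: "sym_diff S S' = {i}" using e by (auto simp: face_graph_def)
  have "S \<in> K" "S' \<in> K" using e by (auto simp: face_graph_def)
  moreover have "T \<in> K"
    using wf_digraph.awalk_last_in_verts p pair_wf_digraph_face_graph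
    by (metis (no_types, lifting) face_graph_def pair_pre_digraph.select_convs(1) wf_digraph_wp_iff with_proj_simps(1))
  ultimately have fin: "finite (sym_diff S' T)" using finite_face by auto
  have "sym_diff S T \<subseteq> insert i (sym_diff S' T)" using i by blast
  then have "card (sym_diff S T) \<le> card (insert i (sym_diff S' T))"
    using fin by (intro card_mono) auto
  also have "\<dots> \<le> Suc (card (sym_diff S' T))" using fin by (simp add: card_insert_if)
  finally show ?case using Cons.IH[OF p] by simp
qed

lemma gdist_face_graph:
  assumes "S \<in> K" "T \<in> K"
  shows "gdist (face_graph K) S T = ereal (real (card (sym_diff S T)))"
  unfolding gdist_eq_INF[OF pair_wf_digraph_face_graph]
proof (rule antisym)
  show "(INF p\<in>{p. pre_digraph.awalk (face_graph K) S p T}. ereal (real (length p)))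
      \<le> ereal (real (card (sym_diff S T)))"
    using awalk_face_graph[OF assms] by (metis (mono_tags, lifting) INF_lower mem_Collect_eq)
  show "ereal (real (card (sym_diff S T)))
      \<le> (INF p\<in>{p. pre_digraph.awalk (face_graph K) S p T}. ereal (real (length p)))"
    using card_sym_diff_le_length_awalk by (auto intro!: INF_greatest)
qed

text \<open>
  The edges that change the vertex \<open>i\<close>, i.e. run in the \<open>i\<close>-th direction of the hypercube. These turn
  out to be the \<open>\<Theta>\<close>-classes.
\<close>

definition direction_class :: "'v \<Rightarrow> 'v set set set" where
  "direction_class i = {{S, insert i S} | S. i \<notin> S \<and> insert i S \<in> K}"

lemma direction_classI: "i \<notin> S \<Longrightarrow> insert i S \<in> K \<Longrightarrow> {S, insert i S} \<in> direction_class i"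
  unfolding direction_class_def mem_Collect_eq by (intro exI[of _ S]) simp

lemma arc_face_graphE:
  assumes "(S, T) \<in> parcs (face_graph K)"
  obtains i where "i \<notin> S" "T = insert i S" "T \<in> K" | i where "i \<notin> T" "S = insert i T" "S \<in> K"
proof -
  obtain i where i: "sym_diff S T = {i}" "S \<in> K" "T \<in> K"
    using assms by (auto simp: face_graph_def)
  note d = i(1)[unfolded sym_diff_eq_singleton_iff]
  show thesis
  proof (cases "i \<in> T")
    case True
    have "i \<notin> S" "T = insert i S" using d True unfolding set_eq_iff insert_iff by metis+
    then show thesis using i(3) by (rule that(1))
  next
    case False
    have "S = insert i T" using d False unfolding set_eq_iff insert_iff by metis
    then show thesis using False i(2) by (intro that(2))
  qed
qed

lemma arc_insert: "i \<notin> S \<Longrightarrow> insert i S \<in> K \<Longrightarrow> (S, insert i S) \<in> parcs (face_graph K)"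
  using face_subset[of "insert i S" S] by (auto simp: face_graph_def)

lemma parcs_face_graph_sym: "(S, T) \<in> parcs (face_graph K) \<Longrightarrow> (T, S) \<in> parcs (face_graph K)"
  by (auto simp: face_graph_def Un_commute)

text \<open>
  The change of the distance to \<open>T\<close> when a face lacking \<open>i\<close> acquires it.
\<close>

definition direction_sign :: "'v \<Rightarrow> 'v set \<Rightarrow> real" where
  "direction_sign i T = (if i \<in> T then -1 else 1)"

lemma card_sym_diff_insert:
  assumes "finite S" "finite T" "i \<notin> S"
  shows "real (card (sym_diff (insert i S) T)) = real (card (sym_diff S T)) + direction_sign i T"
proof (cases "i \<in> T")
  case True
  then have "sym_diff S T = insert i (sym_diff (insert i S) T)" "i \<notin> sym_diff (insert i S) T"
    using assms by auto
  then have "card (sym_diff S T) = Suc (card (sym_diff (insert i S) T))"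
    using assms by (metis card_insert_disjoint finite_Diff finite_UnI finite_insert)
  then show ?thesis using True by (simp add: direction_sign_def)
next
  case False
  then have "sym_diff (insert i S) T = insert i (sym_diff S T)" "i \<notin> sym_diff S T"
    using assms by auto
  then show ?thesis using False assms by (simp add: direction_sign_def)
qed

text \<open>
  The two sums agree iff moving from \<open>S\<close> to \<open>insert i S\<close> changes the distance to \<open>T\<close> and the
  distance to \<open>insert j T\<close> by the same amount. That change depends only on whether the target
  contains \<open>i\<close>, and \<open>T\<close> and \<open>insert j T\<close> disagree about this exactly if \<open>i = j\<close>.
\<close>

lemma gdist_sums_eq_iff:
  assumes "i \<notin> S" "insert i S \<in> K" "j \<notin> T" "insert j T \<in> K"
  shows "gdist (face_graph K) S T + gdist (face_graph K) (insert i S) (insert j T) =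
      gdist (face_graph K) S (insert j T) + gdist (face_graph K) (insert i S) T \<longleftrightarrow> i \<noteq> j"
proof -
  have K: "S \<in> K" "T \<in> K" using assms face_subset by blast+
  have fin: "finite S" "finite T" "finite (insert j T)" using K finite_face by auto
  have "real (card (sym_diff S T)) + real (card (sym_diff (insert i S) (insert j T))) =
      real (card (sym_diff S (insert j T))) + real (card (sym_diff (insert i S) T)) \<longleftrightarrow> i \<noteq> j"
    unfolding card_sym_diff_insert[OF fin(1,2) assms(1)] card_sym_diff_insert[OF fin(1,3) assms(1)]
    using assms(3) by (auto simp: direction_sign_def)
  then show ?thesis
    by (simp only: gdist_face_graph K assms plus_ereal.simps ereal.inject)
qed

lemma Theta_face_graph: "Theta (face_graph K) = (\<Union>i. direction_class i \<times> direction_class i)"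
proof (intro equalityI subsetI)
  fix e assume "e \<in> Theta (face_graph K)"
  then obtain S1 S2 T1 T2 where e: "e = ({S1, S2}, {T1, T2})"
    "(S1, S2) \<in> parcs (face_graph K)" "(T1, T2) \<in> parcs (face_graph K)"
    and d: "gdist (face_graph K) S1 T1 + gdist (face_graph K) S2 T2 \<noteq>
      gdist (face_graph K) S1 T2 + gdist (face_graph K) S2 T1"
    unfolding Theta_def by auto
  \<comment> \<open>Swapping the ends of either edge exchanges the two sums, so upward orientations suffice.\<close>
  have *: "({S, insert i S}, {T, insert j T}) \<in> (\<Union>i. direction_class i \<times> direction_class i)"
    if "i \<notin> S" "insert i S \<in> K" "j \<notin> T" "insert j T \<in> K"
      "gdist (face_graph K) S T + gdist (face_graph K) (insert i S) (insert j T) \<noteq>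
       gdist (face_graph K) S (insert j T) + gdist (face_graph K) (insert i S) T" for S T i j
    using gdist_sums_eq_iff[OF that(1-4)] that by (auto simp: direction_class_def)
  show "e \<in> (\<Union>i. direction_class i \<times> direction_class i)"
    using e(2)
  proof (cases rule: arc_face_graphE)
    case (1 i)
    from e(3) show ?thesis
    proof (cases rule: arc_face_graphE)
      case (1 j)
      then show ?thesis using *[of i S1 j T1] \<open>i \<notin> S1\<close> \<open>S2 = _\<close> \<open>S2 \<in> K\<close> d e(1) by simp
    next
      case (2 j)
      then show ?thesis using *[of i S1 j T2] \<open>i \<notin> S1\<close> \<open>S2 = _\<close> \<open>S2 \<in> K\<close> d e(1)
        by (simp add: insert_commute)
    qed
  next
    case (2 i)
    from e(3) show ?thesis
    proof (cases rule: arc_face_graphE)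
      case (1 j)
      then show ?thesis using *[of i S2 j T1] \<open>i \<notin> S2\<close> \<open>S1 = _\<close> \<open>S1 \<in> K\<close> d e(1)
        by (simp add: insert_commute add.commute)
    next
      case (2 j)
      then show ?thesis using *[of i S2 j T2] \<open>i \<notin> S2\<close> \<open>S1 = _\<close> \<open>S1 \<in> K\<close> d e(1)
        by (simp add: insert_commute add.commute)
    qed
  qed
next
  fix e assume "e \<in> (\<Union>i. direction_class i \<times> direction_class i)"
  then obtain i S T where e: "e = ({S, insert i S}, {T, insert i T})"
    and S: "i \<notin> S" "insert i S \<in> K" and T: "i \<notin> T" "insert i T \<in> K"
    by (auto simp: direction_class_def)
  then show "e \<in> Theta (face_graph K)"
    using gdist_sums_eq_iff[OF S T] arc_insert[OF S] arc_insert[OF T]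
    unfolding Theta_def by blast
qed

text \<open>
  An edge determines its direction, so distinct direction classes are disjoint.
\<close>

lemma sym_diff_direction_class: "{S, T} \<in> direction_class i \<Longrightarrow> sym_diff S T = {i}"
proof -
  assume "{S, T} \<in> direction_class i"
  then obtain U where "i \<notin> U" and "{S, T} = {U, insert i U}"
    by (auto simp: direction_class_def)
  then consider "S = U" "T = insert i U" | "S = insert i U" "T = U"
    by (metis doubleton_eq_iff)
  then show ?thesis using \<open>i \<notin> U\<close> by cases auto
qed

lemma direction_class_unique:
  assumes "e \<in> direction_class i" "e \<in> direction_class j" shows "i = j"
proof -
  obtain S where "e = {S, insert i S}" using assms(1) by (auto simp: direction_class_def)
  then show ?thesis
    using sym_diff_direction_class assms by (metis singleton_inject)
qed

lemma edges_face_graph: "edges (face_graph K) = (\<Union>i. direction_class i)"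
proof (intro equalityI subsetI)
  fix e assume "e \<in> edges (face_graph K)"
  then obtain S T where e: "e = {S, T}" "(S, T) \<in> parcs (face_graph K)"
    by (auto simp: edges_def)
  from e(2) show "e \<in> (\<Union>i. direction_class i)"
    by (cases rule: arc_face_graphE) (auto simp: direction_class_def e(1))
next
  fix e assume "e \<in> (\<Union>i. direction_class i)"
  then show "e \<in> edges (face_graph K)"
    unfolding direction_class_def edges_def by (force dest: arc_insert)
qed

lemma direction_class_nonempty_iff: "direction_class i \<noteq> {} \<longleftrightarrow> i \<in> \<Union>K"
proof
  show "i \<in> \<Union>K" if "direction_class i \<noteq> {}"
    using that by (auto simp: direction_class_def)
next
  assume "i \<in> \<Union>K"
  then have "insert i {} \<in> K" using face_subset by blast
  then show "direction_class i \<noteq> {}" by (auto simp: direction_class_def)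
qed

lemma Theta_classes_face_graph: "Theta_classes (face_graph K) = direction_class ` \<Union>K"
proof -
  have Theta_class: "Theta (face_graph K) `` {e} = direction_class i" if "e \<in> direction_class i" for e i
    using that direction_class_unique unfolding Theta_face_graph by blast
  have "Theta_classes (face_graph K) = (\<Union>i. \<Union>e\<in>direction_class i. {direction_class i})"
    unfolding Theta_classes_def quotient_def edges_face_graph using Theta_class by auto
  also have "\<dots> = direction_class ` {i. direction_class i \<noteq> {}}" by blast
  finally have "Theta_classes (face_graph K) = direction_class ` {i. direction_class i \<noteq> {}}" .
  then show ?thesis by (simp only: direction_class_nonempty_iff Collect_mem_eq)
qed

lemma inj_on_direction_class: "inj_on direction_class (\<Union>K)"
  using direction_class_unique direction_class_nonempty_iff by (metis all_not_in_conv inj_onI)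

section \<open>The \<open>\<tau>\<close>-graph of a graph of faces\<close>

text \<open>
  Adjacency in the \<open>\<tau>\<close>-graph, expressed by vertices of the complex: in the square spanned by
  \<open>S\<close>, \<open>i\<close> and \<open>j\<close>, all corners but the top one are faces.
\<close>

definition tau_adjacent :: "'v \<Rightarrow> 'v \<Rightarrow> bool" where
  "tau_adjacent i j \<longleftrightarrow> i \<noteq> j \<and>
     (\<exists>S. i \<notin> S \<and> j \<notin> S \<and> insert i S \<in> K \<and> insert j S \<in> K \<and> insert i (insert j S) \<notin> K)"

lemma tau_adjacent_vertex: "tau_adjacent i j \<Longrightarrow> i \<in> \<Union>K"
  by (auto simp: tau_adjacent_def)

text \<open>
  The path spans a square of the hypercube. Its fourth corner \<open>V'\<close> is a common neighbour of the ends,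
  so convexity excludes it from \<open>K\<close>. By downward closure \<open>V'\<close> is contained in neither end of the
  path; so both changes lead upwards from \<open>V\<close>, and \<open>V'\<close> is the top of the square.
\<close>

lemma tau_adjacent_if_convex_path3:
  assumes E: "{U, V} \<in> direction_class i" and F: "{V, W} \<in> direction_class j"
    and path: "convex_path3 (face_graph K) U V W" and "i \<noteq> j"
  shows "tau_adjacent i j"
proof -
  have UVW: "U \<in> K" "V \<in> K" "W \<in> K"
    using convex_path3_pverts[OF pair_wf_digraph_face_graph path] by (auto simp: face_graph_def)
  have UV: "sym_diff U V = {i}" by (rule sym_diff_direction_class[OF E])
  have VW: "sym_diff V W = {j}" by (rule sym_diff_direction_class[OF F])
  define V' where "V' = sym_diff U {j}"
  have UV': "sym_diff U V' = {j}" and V'W: "sym_diff V' W = {i}"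
    using UV VW \<open>i \<noteq> j\<close> unfolding V'_def sym_diff_eq_singleton_iff Un_iff Diff_iff singleton_iff
    by metis+
  note eqs = UV[unfolded sym_diff_eq_singleton_iff] VW[unfolded sym_diff_eq_singleton_iff]
    UV'[unfolded sym_diff_eq_singleton_iff] V'W[unfolded sym_diff_eq_singleton_iff]
  have "V' \<noteq> V" using eqs \<open>i \<noteq> j\<close> by metis
  moreover have "(U, V') \<in> parcs (face_graph K)" "(V', W) \<in> parcs (face_graph K)" if "V' \<in> K"
    unfolding face_graph_def using that UVW UV' V'W by simp_all
  ultimately have V': "V' \<notin> K"
    using path unfolding convex_path3_def by blast
  then have "\<not> V' \<subseteq> U" "\<not> V' \<subseteq> W" using UVW face_subset by blast+
  then have j: "j \<notin> U" and i: "i \<notin> W"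
    using eqs unfolding subset_iff by metis+
  have "i \<notin> V" "j \<notin> V" using eqs i j \<open>i \<noteq> j\<close> by metis+
  moreover have "insert i V = U" "insert j V = W" "insert i (insert j V) = V'"
    using eqs i j \<open>i \<noteq> j\<close> unfolding set_eq_iff insert_iff by metis+
  ultimately show ?thesis
    using UVW V' \<open>i \<noteq> j\<close> unfolding tau_adjacent_def by blast
qed

text \<open>
  The path leads through the bottom \<open>S\<close> of the square: the only common neighbours of
  \<open>insert i S\<close> and \<open>insert j S\<close> in the hypercube are \<open>S\<close> and the top, which is not a face.
\<close>

lemma convex_path3_if_tau_adjacent:
  assumes "tau_adjacent i j"
  shows "\<exists>U V W. {U, V} \<in> direction_class i \<and> {V, W} \<in> direction_class j \<and>
    convex_path3 (face_graph K) U V W"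
proof -
  obtain S where S: "i \<noteq> j" "i \<notin> S" "j \<notin> S" "insert i S \<in> K" "insert j S \<in> K"
      "insert i (insert j S) \<notin> K"
    using assms by (auto simp: tau_adjacent_def)
  have "X = S" if X: "(insert i S, X) \<in> parcs (face_graph K)" "(X, insert j S) \<in> parcs (face_graph K)" for X
  proof -
    obtain a b where ab: "sym_diff (insert i S) X = {a}" "sym_diff X (insert j S) = {b}" and "X \<in> K"
      using X unfolding parcs_face_graph_iff by metis
    have "X \<noteq> insert i (insert j S)" using \<open>X \<in> K\<close> S by blast
    moreover have "X = S \<or> X = insert i (insert j S)"
      using ab[unfolded sym_diff_eq_singleton_iff] S(1-3)
      unfolding set_eq_iff insert_iff by metis
    ultimately show ?thesis by blast
  qed
  moreover have "(insert i S, insert j S) \<notin> parcs (face_graph K)"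
  proof
    assume "(insert i S, insert j S) \<in> parcs (face_graph K)"
    then obtain a where "sym_diff (insert i S) (insert j S) = {a}"
      unfolding parcs_face_graph_iff by metis
    then show False using S(1-3) unfolding sym_diff_eq_singleton_iff by (metis insert_iff)
  qed
  moreover have "insert i S \<noteq> insert j S" using S by blast
  ultimately have "convex_path3 (face_graph K) (insert i S) S (insert j S)"
    using S arc_insert parcs_face_graph_sym by (auto simp: convex_path3_def)
  moreover have "{insert i S, S} \<in> direction_class i" "{S, insert j S} \<in> direction_class j"
    using direction_classI[of i S] direction_classI[of j S] S by (simp_all add: insert_commute)
  ultimately show ?thesis by blast
qed

lemma parcs_tau_graph_face_graph:
  assumes "i \<in> \<Union>K" "j \<in> \<Union>K"
  shows "(direction_class i, direction_class j) \<in> parcs (tau_graph (face_graph K)) \<longleftrightarrow> tau_adjacent i j"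
proof -
  have "direction_class i = direction_class j \<longleftrightarrow> i = j"
    using assms inj_on_direction_class by (auto dest: inj_onD)
  moreover have "direction_class i \<in> Theta_classes (face_graph K)"
      "direction_class j \<in> Theta_classes (face_graph K)"
    using assms unfolding Theta_classes_face_graph by blast+
  moreover have "tau_adjacent i j \<longleftrightarrow> i \<noteq> j \<and> (\<exists>U V W. {U, V} \<in> direction_class i \<and>
      {V, W} \<in> direction_class j \<and> convex_path3 (face_graph K) U V W)"
  proof
    assume "tau_adjacent i j"
    then show "i \<noteq> j \<and> (\<exists>U V W. {U, V} \<in> direction_class i \<and>
        {V, W} \<in> direction_class j \<and> convex_path3 (face_graph K) U V W)"
      using convex_path3_if_tau_adjacent[of i j] by (simp add: tau_adjacent_def)
  qed (elim conjE exE, rule tau_adjacent_if_convex_path3)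
  ultimately show ?thesis by (simp add: tau_graph_def)
qed

lemma minimal_nonface:
  assumes "finite S" "S \<notin> K"
  obtains M where "M \<subseteq> S" "M \<notin> K" "\<And>i. i \<in> M \<Longrightarrow> M - {i} \<in> K"
  using assms
proof (induction S arbitrary: thesis rule: finite_psubset_induct)
  case (psubset S)
  show ?case
  proof (cases "\<forall>i\<in>S. S - {i} \<in> K")
    case True
    then show ?thesis using psubset.prems by blast
  next
    case False
    then obtain i where i: "i \<in> S" "S - {i} \<notin> K" by blast
    show ?thesis
      by (rule psubset.IH[of "S - {i}"]) (use i psubset.prems in auto)
  qed
qed

text \<open>
  The square witnessing adjacency has bottom \<open>M - {i, j}\<close> and top \<open>M\<close>; its middle corners are faces by
  minimality.
\<close>

lemma minimal_nonface_tau_clique: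
  assumes M: "M \<notin> K" "\<And>i. i \<in> M \<Longrightarrow> M - {i} \<in> K" and "i \<in> M" "j \<in> M" "i \<noteq> j"
  shows "tau_adjacent i j"
proof -
  have "insert i (M - {i, j}) = M - {j}" "insert j (M - {i, j}) = M - {i}"
    "insert i (insert j (M - {i, j})) = M"
    using assms by auto
  then show ?thesis
    using assms unfolding tau_adjacent_def by (metis Diff_iff insertI1 insertI2)
qed

text \<open>
  A minimal nonface made of vertices is a clique of the \<open>\<tau>\<close>-graph with at least two elements, hence
  with exactly two if there are no triangles. So a nonface contains two adjacent vertices that do
  not form a face. Conversely, adjacent \<open>i\<close> and \<open>j\<close> do not form a face: the top of a square
  witnessing their adjacency contains a nonface of size two, which lies in neither of the middle
  corners and so can only be \<open>{i, j}\<close>.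
\<close>

lemma face_iff_no_tau_adjacent:
  assumes tf: "triangle_free (tau_graph (face_graph K))"
  shows "S \<in> K \<longleftrightarrow> finite S \<and> S \<subseteq> \<Union>K \<and> (\<forall>i\<in>S. \<forall>j\<in>S. \<not> tau_adjacent i j)"
proof -
  have tf': False if "tau_adjacent a b" "tau_adjacent b c" "tau_adjacent c a" for a b c
  proof -
    have V: "a \<in> \<Union>K" "b \<in> \<Union>K" "c \<in> \<Union>K" using that tau_adjacent_vertex by blast+
    have "a \<noteq> b" "b \<noteq> c" "a \<noteq> c" using that by (auto simp: tau_adjacent_def)
    then have "direction_class a \<noteq> direction_class b" "direction_class b \<noteq> direction_class c"
      "direction_class a \<noteq> direction_class c"
      using V inj_on_direction_class by (auto dest: inj_onD)
    then show False
      using tf that V parcs_tau_graph_face_graph unfolding triangle_free_def by blast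
  qed
  have pair: "\<exists>i\<in>S. \<exists>j\<in>S. i \<noteq> j \<and> {i, j} \<notin> K \<and> tau_adjacent i j"
    if S: "finite S" "S \<subseteq> \<Union>K" "S \<notin> K" for S
  proof -
    obtain M where M: "M \<subseteq> S" "M \<notin> K" "\<And>i. i \<in> M \<Longrightarrow> M - {i} \<in> K"
      using minimal_nonface[OF S(1,3)] by blast
    have adj: "tau_adjacent i j" if "i \<in> M" "j \<in> M" "i \<noteq> j" for i j
      using minimal_nonface_tau_clique[OF M(2,3)] that by blast
    have "M \<noteq> {}" using M(2) empty_face by auto
    then obtain i where i: "i \<in> M" by blast
    have "{i} \<in> K" using i M(1) S(2) face_subset by blast
    then have "M \<noteq> {i}" using M(2) by blast
    then obtain j where j: "j \<in> M" "i \<noteq> j" using i by blast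
    have "M = {i, j}"
      using i j adj tf' by blast
    then show ?thesis using i j M(1,2) adj by blast
  qed
  have no_edge: "{i, j} \<notin> K" if ij: "tau_adjacent i j" for i j
  proof
    assume ijK: "{i, j} \<in> K"
    obtain T where T: "i \<notin> T" "j \<notin> T" "insert i T \<in> K" "insert j T \<in> K" "insert i (insert j T) \<notin> K"
      using ij by (auto simp: tau_adjacent_def)
    have V: "finite (insert i (insert j T))" "insert i (insert j T) \<subseteq> \<Union>K"
      using T finite_face[of "insert i T"] by auto
    then obtain a b where ab: "a \<in> insert i (insert j T)" "b \<in> insert i (insert j T)" "{a, b} \<notin> K"
      using pair[OF V T(5)] by metis
    have "{a, b} \<subseteq> insert i T \<or> {a, b} \<subseteq> insert j T \<or> {a, b} \<subseteq> {i, j}"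
      using ab(1,2) by auto
    then show False using face_subset[OF T(3)] face_subset[OF T(4)] face_subset[OF ijK] ab(3) by metis
  qed
  show ?thesis
  proof
    assume S: "S \<in> K"
    have "\<not> tau_adjacent i j" if "i \<in> S" "j \<in> S" for i j
      using no_edge[of i j] face_subset[OF S, of "{i, j}"] that by auto
    then show "finite S \<and> S \<subseteq> \<Union>K \<and> (\<forall>i\<in>S. \<forall>j\<in>S. \<not> tau_adjacent i j)"
      using S finite_face by auto
  next
    assume "finite S \<and> S \<subseteq> \<Union>K \<and> (\<forall>i\<in>S. \<forall>j\<in>S. \<not> tau_adjacent i j)"
    then show "S \<in> K" using pair by metis
  qed
qed

end

section \<open>The \<open>\<tau>\<close>-graph determines the complex\<close>

text \<open>
  The map of \<open>\<Theta>\<close>-classes is read as a bijection \<open>\<phi>\<close> of the vertices of the complexes. It preserves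
  adjacency in the \<open>\<tau>\<close>-graphs, thus faces, and taking images under \<open>\<phi>\<close> preserves the size of
  symmetric differences.
\<close>

lemma face_graph_iso_if_tau_graph_iso:
  fixes K :: "'v set set" and L :: "'w set set"
  assumes "simplicial_complex K" "simplicial_complex L"
    and tfK: "triangle_free (tau_graph (face_graph K))"
    and tfL: "triangle_free (tau_graph (face_graph L))"
    and g: "graph_iso g (tau_graph (face_graph K)) (tau_graph (face_graph L))"
  shows "\<exists>f. graph_iso f (face_graph K) (face_graph L)"
proof -
  interpret K: simplicial_complex K by fact
  interpret L: simplicial_complex L by fact
  have cK: "bij_betw K.direction_class (\<Union>K) (pverts (tau_graph (face_graph K)))"
    using K.inj_on_direction_class by (simp add: bij_betw_def tau_graph_def K.Theta_classes_face_graph)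
  have cL: "bij_betw L.direction_class (\<Union>L) (pverts (tau_graph (face_graph L)))"
    using L.inj_on_direction_class by (simp add: bij_betw_def tau_graph_def L.Theta_classes_face_graph)
  define \<phi> where "\<phi> = inv_into (\<Union>L) L.direction_class \<circ> (g \<circ> K.direction_class)"
  have bij: "bij_betw \<phi> (\<Union>K) (\<Union>L)"
    unfolding \<phi>_def using g cK bij_betw_inv_into[OF cL]
    by (auto simp: graph_iso_def intro: bij_betw_trans)
  have g_\<phi>: "L.direction_class (\<phi> i) = g (K.direction_class i)" if "i \<in> \<Union>K" for i
  proof -
    have "g (K.direction_class i) \<in> pverts (tau_graph (face_graph L))"
      using that cK graph_isoD(4)[OF g] by (metis bij_betwE imageI)
    then show ?thesis
      unfolding \<phi>_def using cL by (simp add: bij_betw_def f_inv_into_f)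
  qed
  have adj: "L.tau_adjacent (\<phi> i) (\<phi> j) \<longleftrightarrow> K.tau_adjacent i j" if "i \<in> \<Union>K" "j \<in> \<Union>K" for i j
  proof -
    have "\<phi> i \<in> \<Union>L" "\<phi> j \<in> \<Union>L" using that bij by (auto dest: bij_betwE)
    then have "L.tau_adjacent (\<phi> i) (\<phi> j) \<longleftrightarrow>
        (g (K.direction_class i), g (K.direction_class j)) \<in> parcs (tau_graph (face_graph L))"
      using L.parcs_tau_graph_face_graph g_\<phi> that by metis
    also have "\<dots> \<longleftrightarrow> (K.direction_class i, K.direction_class j) \<in> parcs (tau_graph (face_graph K))"
      using that cK by (intro graph_isoD(5)[OF g]) (auto dest: bij_betwE)
    finally show ?thesis using K.parcs_tau_graph_face_graph that by simp
  qed
  have inj: "inj_on \<phi> (\<Union>K)" and img: "\<phi> ` \<Union>K = \<Union>L" using bij by (auto simp: bij_betw_def)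
  have face: "\<phi> ` S \<in> L \<longleftrightarrow> S \<in> K" if S: "S \<subseteq> \<Union>K" for S
  proof -
    have "finite (\<phi> ` S) \<longleftrightarrow> finite S"
      using inj_on_subset[OF inj S] by (rule finite_image_iff)
    moreover have "\<phi> ` S \<subseteq> \<Union>L" using S img by blast
    moreover have "(\<forall>i\<in>\<phi> ` S. \<forall>j\<in>\<phi> ` S. \<not> L.tau_adjacent i j) \<longleftrightarrow> (\<forall>i\<in>S. \<forall>j\<in>S. \<not> K.tau_adjacent i j)"
      using adj S by (auto simp: subset_iff)
    ultimately show ?thesis
      using S K.face_iff_no_tau_adjacent[OF tfK, of S] L.face_iff_no_tau_adjacent[OF tfL, of "\<phi> ` S"]
      by simp
  qed
  have injF: "inj_on (image \<phi>) K"
    using inj by (meson Union_upper inj_on_def inj_on_image_eq_iff)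
  have imgF: "image \<phi> ` K = L"
  proof (intro equalityI subsetI)
    fix T assume T: "T \<in> L"
    then obtain S where "S \<subseteq> \<Union>K" "T = \<phi> ` S" using img by (metis Union_upper subset_imageE)
    then show "T \<in> image \<phi> ` K" using face T by blast
  qed (use face in blast)
  have arcs: "(S, T) \<in> parcs (face_graph K) \<longleftrightarrow> (\<phi> ` S, \<phi> ` T) \<in> parcs (face_graph L)"
    if ST: "S \<in> K" "T \<in> K" for S T
  proof -
    have sub: "S \<subseteq> \<Union>K" "T \<subseteq> \<Union>K" using ST by auto
    then have "\<phi> ` (S - T) = \<phi> ` S - \<phi> ` T" "\<phi> ` (T - S) = \<phi> ` T - \<phi> ` S"
      by (auto intro!: inj_on_image_set_diff[OF inj])
    then have "sym_diff (\<phi> ` S) (\<phi> ` T) = \<phi> ` sym_diff S T"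
      by (simp only: image_Un)
    moreover have "(\<exists>i. \<phi> ` sym_diff S T = {i}) \<longleftrightarrow> (\<exists>i. sym_diff S T = {i})"
    proof -
      have "inj_on \<phi> (sym_diff S T)" using sub by (intro inj_on_subset[OF inj]) auto
      then have "card (\<phi> ` sym_diff S T) = card (sym_diff S T)" by (rule card_image)
      then show ?thesis by (metis card_1_singleton_iff One_nat_def)
    qed
    moreover have "\<phi> ` S \<in> L" "\<phi> ` T \<in> L" using ST imgF by blast+
    ultimately show ?thesis using ST by (simp add: face_graph_def)
  qed
  have "graph_iso (image \<phi>) (face_graph K) (face_graph L)"
    unfolding graph_iso_def
    using injF imgF arcs by (auto simp: pair_wf_digraph_face_graph bij_betw_def)
      (auto simp: face_graph_def)
  then show ?thesis by blast
qed

theorem corollary3p3: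
  fixes A :: "'a pair_pre_digraph" and B :: "'b pair_pre_digraph"
  assumes "is_daisy_cube A" and "is_daisy_cube B"
    and "is_forest (tau_graph A)" and "is_forest (tau_graph B)"
  shows "digraph_iso A B \<longleftrightarrow> digraph_iso (tau_graph A) (tau_graph B)"
proof
  assume "digraph_iso A B"
  then show "digraph_iso (tau_graph A) (tau_graph B)"
    using graph_iso_tau_graph by (auto simp: digraph_iso_iff_graph_iso)
next
  assume "digraph_iso (tau_graph A) (tau_graph B)"
  then obtain t where t: "graph_iso t (tau_graph A) (tau_graph B)"
    by (auto simp: digraph_iso_iff_graph_iso)
  obtain f and K :: "nat set set" where K: "simplicial_complex K" "graph_iso f A (face_graph K)"
    using is_daisy_cubeE[OF assms(1)] .
  obtain g and L :: "nat set set" where L: "simplicial_complex L" "graph_iso g B (face_graph L)"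
    using is_daisy_cubeE[OF assms(2)] .
  note KA = graph_iso_tau_graph[OF graph_iso_sym[OF K(2)]]
    and LB = graph_iso_tau_graph[OF graph_iso_sym[OF L(2)]]
  have "triangle_free (tau_graph A)" "triangle_free (tau_graph B)"
    using assms triangle_free_if_is_forest pair_wf_digraph_tau_graph by blast+
  then have tf: "triangle_free (tau_graph (face_graph K))" "triangle_free (tau_graph (face_graph L))"
    using triangle_free_graph_iso KA LB by blast+
  have "\<exists>h. graph_iso h (tau_graph (face_graph K)) (tau_graph (face_graph L))"
    using graph_iso_trans[OF graph_iso_trans[OF KA t] graph_iso_tau_graph[OF L(2)]] by blast
  then obtain h where h: "graph_iso h (face_graph K) (face_graph L)"
    using face_graph_iso_if_tau_graph_iso[OF K(1) L(1) tf] by blast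
  have "graph_iso (inv_into (pverts B) g \<circ> (h \<circ> f)) A B"
    by (rule graph_iso_trans[OF graph_iso_trans[OF K(2) h] graph_iso_sym[OF L(2)]])
  then show "digraph_iso A B"
    by (auto simp: digraph_iso_iff_graph_iso)
qed

end
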